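(* Let $n\ge 1$ and let $A_1,\ldots,A_n\in \mathrm{SL}(2,\mathbb{R})$. Then $$\frac{1}{2\pi}\int_0^{2\pi}\rho(R_\theta A_n\cdots R_\theta A_1)\,d\theta=\sum_{j=1}^n\int_{\mathbb{P}^1}\log\|A_j\,p\|\,dp .$$
   Context: $R_\theta=\begin{bmatrix}\cos\theta&-\sin\theta\\ \sin\theta&\cos\theta\end{bmatrix}$ is the rotation by angle $\theta$; $R_\theta A_n\cdots R_\theta A_1$ is the product $(R_\theta A_n)(R_\theta A_{n-1})\cdots(R_\theta A_1)$. For a matrix $A$, $\rho(A)$ denotes the logarithm of the spectral radius of $A$. $\|\cdot\|$ is the Euclidean norm. The real projective line is modelled as $\mathbb{P}^1=\mathbb{R}/\pi\mathbb{Z}$, where $p\in\mathbb{P}^1$ corresponds to the line spanned by the unit vector $v_p=(\cos p,\sin p)\in\mathbb{R}^2$; $\|A\,p\|$ means $\|A\,v_p\|$, and $\int_{\mathbb{P}^1}\,\cdot\,dp$ is integration with respect to the normalized (probability) Haar measure, i.e. $\int_{\mathbb{P}^1}g(p)\,dp=\frac1\pi\int_{-\pi/2}^{\pi/2}g(t)\,dt$. *)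

theory Defs
  imports "HOL-Analysis.Analysis" "Jordan_Normal_Form.Spectral_Radius"
begin

(* HOL-Analysis also has a det, for matrices of type 'a ^ 'n ^ 'n. *)
hide_const (open) Determinants.det

definition SL2 :: "real mat set" where
  "SL2 = {A \<in> carrier_mat 2 2. det A = 1}"

definition rotation :: "real \<Rightarrow> real mat" where
  "rotation \<theta> = mat_of_rows_list 2 [[cos \<theta>, - sin \<theta>], [sin \<theta>, cos \<theta>]]"

(* (R A_n) (R A_{n-1}) ... (R A_1); new factors are multiplied on the left. *)
primrec rotated_product :: "real \<Rightarrow> (nat \<Rightarrow> real mat) \<Rightarrow> nat \<Rightarrow> real mat" where
  "rotated_product \<theta> A 0 = 1\<^sub>m 2"
| "rotated_product \<theta> A (Suc k) = (rotation \<theta> * A (Suc k)) * rotated_product \<theta> A k"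

(* The matrix is complexified because spectral_radius is the maximal modulus of the
   complex eigenvalues. *)
definition log_spectral_radius :: "real mat \<Rightarrow> real" where
  "log_spectral_radius A = ln (spectral_radius (map_mat complex_of_real A))"

definition euclidean_norm :: "real vec \<Rightarrow> real" where
  "euclidean_norm v = sqrt (scalar_prod v v)"

definition line_vec :: "real \<Rightarrow> real vec" where
  "line_vec p = vec_of_list [cos p, sin p]"

(* A point of the projective line R / pi Z is given by a representative p, standing for the
   line spanned by line_vec p; functions on the projective line are pi-periodic functions of p,
   and the integral is the one for the Haar probability measure. *)
definition proj_integral :: "(real \<Rightarrow> real) \<Rightarrow> real" where
  "proj_integral g = (1 / pi) * (LBINT t=-(pi/2)..pi/2. g t)"

end

theory Submission
  imports Defs "HOL-Complex_Analysis.Complex_Analysis" "HOL-Real_Asymp.Real_Asymp"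
begin

text \<open>
  Write a real matrix as \<open>z \<mapsto> a * z + b * cnj z\<close> on the complex plane, with conformal part \<open>a\<close> and
  anticonformal part \<open>b\<close>. A matrix of determinant one satisfies \<open>(norm a)\<^sup>2 - (norm b)\<^sup>2 = 1\<close>, and
  a rotation in front multiplies both parts by \<open>cis \<theta>\<close>.

  The right-hand side is a mean value. The expansion of the line at angle \<open>p\<close> is \<open>norm (a + b * w)\<close> with
  \<open>w = cis (- 2 * p)\<close>, and \<open>a + b * w\<close> has no zeros in the closed unit disc, so the average of its
  logarithm is \<open>ln (norm a)\<close> (\<open>proj_integral_ln_norm_SL2\<close>).

  The left-hand side is a limit of mean values. Up to a factor of modulus one, the conformal part of the
  rotated product is a polynomial in \<open>w = cis (- 2 * \<theta>)\<close>. An indefinite form that does not decrease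
  along the product (\<open>disc_indefinite_form_ge_1\<close>) shows that this polynomial has no zeros in the closed
  disc, and its value at \<open>w = 0\<close> is the product of the conformal parts of the factors. Hence the average
  over \<open>\<theta>\<close> of the logarithm of the modulus of the conformal part of the product is the sum of the
  numbers \<open>ln (norm a)\<close> of the factors (\<open>disc_conformal_circle_average\<close>): the formula holds
  exactly with the conformal part in place of the spectral radius.

  To pass to the spectral radius, repeat the factors periodically. This replaces the product by its
  \<open>k\<close>-th power (\<open>rotated_product_repeat_periodically\<close>) and multiplies the average by \<open>k\<close>. After division
  by \<open>k\<close>, Gelfand's formula gives the logarithm of the spectral radius at every angle
  (\<open>ln_conformal_part_power_tendsto\<close>), because the conformal part of a matrix of determinant one is
  comparable to its norm. The convergence is dominated, while the averages do not depend on \<open>k\<close>.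
\<close>

section \<open>Averages of logarithms of holomorphic functions over the circle\<close>

text \<open>
  The mean value property along the loop \<open>t \<mapsto> cis (- 2 * t)\<close>, traversed any number of
  times. The quotient \<open>(f z - f 0) / z\<close> has a primitive \<open>Q\<close> on the disc, and up to a constant factor
  \<open>f - f 0\<close> is the derivative of \<open>Q\<close> along the loop, so its integral telescopes to zero. A
  primitive treats all winding numbers alike, and two of them occur: the projective line is one turn of
  the loop, and a full period of the rotation angle is two turns.
\<close>
lemma holomorphic_circle_average:
  fixes f :: "complex \<Rightarrow> complex"
  assumes f: "f holomorphic_on ball 0 R" and R: "1 < R"
    and ab: "a \<le> b" and closed_loop: "cis (- 2 * a) = cis (- 2 * b)"
  shows "((\<lambda>t. f (cis (- 2 * t))) has_integral of_real (b - a) * f 0) {a..b}"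
proof -
  define q where "q = (\<lambda>z. if z = 0 then deriv f 0 else (f z - f 0) / (z - 0))"
  have "q holomorphic_on ball 0 R"
    unfolding q_def using f by (rule pole_lemma_open) simp
  then obtain Q where Q: "\<And>z. z \<in> ball 0 R \<Longrightarrow> (Q has_field_derivative q z) (at z within ball 0 R)"
    using holomorphic_convex_primitive'[of "ball 0 R" q] by auto
  have Q': "(Q has_field_derivative q z) (at z)" if "norm z = 1" for z
    using Q[of z] at_within_open[of z "ball 0 R"] that R by simp
  have deriv: "((\<lambda>t. \<i> / 2 * Q (cis (- 2 * t))) has_vector_derivative (f (cis (- 2 * t)) - f 0)) (at t within {a..b})"
    for t
  proof -
    have cis_deriv: "((\<lambda>t. cis (- 2 * t)) has_vector_derivative (- 2 * \<i> * cis (- 2 * t))) (at t within {a..b})"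
    proof -
      have "((\<lambda>z. exp (- 2 * \<i> * z)) has_field_derivative - 2 * \<i> * exp (- 2 * \<i> * of_real t)) (at (of_real t))"
        by (auto intro!: derivative_eq_intros)
      then show ?thesis
        using has_vector_derivative_real_field[of "\<lambda>z. exp (- 2 * \<i> * z)" _ t "{a..b}"]
        by (simp add: cis_conv_exp mult_ac)
    qed
    have "((Q \<circ> (\<lambda>t. cis (- 2 * t))) has_vector_derivative (- 2 * \<i> * cis (- 2 * t)) * q (cis (- 2 * t))) (at t within {a..b})"
      by (rule field_vector_diff_chain_within[OF cis_deriv])
         (auto intro!: has_field_derivative_at_within Q')
    then have "((\<lambda>t. \<i> / 2 * (Q \<circ> (\<lambda>t. cis (- 2 * t))) t) has_vector_derivative
        (\<i> / 2 * ((- 2 * \<i> * cis (- 2 * t)) * q (cis (- 2 * t))))) (at t within {a..b})"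
      by (rule has_vector_derivative_mult_right)
    moreover have "\<i> / 2 * ((- 2 * \<i> * cis (- 2 * t)) * q (cis (- 2 * t))) = f (cis (- 2 * t)) - f 0"
      by (simp add: q_def)
    ultimately show ?thesis by (simp add: o_def)
  qed
  have "((\<lambda>t. f (cis (- 2 * t)) - f 0) has_integral
      (\<i> / 2 * Q (cis (- 2 * b)) - \<i> / 2 * Q (cis (- 2 * a)))) {a..b}"
    using ab deriv by (intro fundamental_theorem_of_calculus) auto
  then have "((\<lambda>t. f (cis (- 2 * t)) - f 0) has_integral 0) {a..b}"
    using closed_loop by simp
  moreover have "((\<lambda>t. f 0) has_integral of_real (b - a) * f 0) {a..b}"
    using has_integral_const_real[of "f 0" a b] ab by (simp add: scaleR_conv_of_real)
  ultimately show ?thesis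
    using has_integral_add[of "\<lambda>t. f (cis (- 2 * t)) - f 0" 0 "{a..b}" "\<lambda>t. f 0"] by auto
qed

text \<open>
  The case of Jensen's formula without zeros: \<open>ln (norm f)\<close> is the real part of a holomorphic
  logarithm of \<open>f\<close>. The logarithm is taken on a disc slightly larger than the unit disc, where \<open>f\<close> still
  has no zeros by compactness, so that it is holomorphic up to the circle of integration.
\<close>
lemma ln_norm_circle_average:
  fixes f :: "complex \<Rightarrow> complex"
  assumes f: "f holomorphic_on UNIV" and nz: "\<And>w. norm w \<le> 1 \<Longrightarrow> f w \<noteq> 0"
    and ab: "a \<le> b" and closed_loop: "cis (- 2 * a) = cis (- 2 * b)"
  shows "((\<lambda>t. ln (norm (f (cis (- 2 * t))))) has_integral (b - a) * ln (norm (f 0))) {a..b}"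
proof -
  have "open (f -` (- {0}))"
    using f by (intro open_vimage holomorphic_on_imp_continuous_on) auto
  moreover have "cball 0 1 \<subseteq> f -` (- {0})"
    using nz by auto
  ultimately obtain e where e: "e > 0" "(\<Union>x\<in>cball 0 1. ball x e) \<subseteq> f -` (- {0})"
    using compact_subset_open_imp_ball_epsilon_subset[OF compact_cball] by metis
  have nz': "f w \<noteq> 0" if w: "w \<in> ball 0 (1 + e)" for w
  proof (cases "norm w \<le> 1")
    case False
    have "dist (sgn w) w = norm ((inverse (norm w) - 1) *\<^sub>R w)"
      by (simp add: sgn_div_norm dist_norm algebra_simps)
    also have "\<dots> = norm w - 1"
      using False unfolding norm_scaleR by (cases "w = 0") (auto simp: abs_if field_simps)
    finally have "w \<in> ball (sgn w) e"
      using w by (simp add: dist_norm)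
    moreover have "sgn w \<in> cball 0 1"
      by (simp add: norm_sgn)
    ultimately show ?thesis
      using e(2) by blast
  qed (rule nz)
  obtain g where g: "g holomorphic_on ball 0 (1 + e)" "\<And>w. w \<in> ball 0 (1 + e) \<Longrightarrow> exp (g w) = f w"
    using holomorphic_logarithm_exists[of "ball 0 (1 + e)" f 0] nz' e(1)
      holomorphic_on_subset[OF f, of "ball 0 (1 + e)"] by auto
  have ln_f: "ln (norm (f w)) = Re (g w)" if "norm w \<le> 1" for w
  proof -
    have "norm (f w) = exp (Re (g w))"
      using g(2)[of w] that e(1) norm_exp_eq_Re[of "g w"] by simp
    then show ?thesis by simp
  qed
  have "((\<lambda>t. g (cis (- 2 * t))) has_integral of_real (b - a) * g 0) {a..b}"
    using holomorphic_circle_average[OF g(1) _ ab closed_loop] e(1) by simp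
  then have "((\<lambda>t. Re (g (cis (- 2 * t)))) has_integral Re (of_real (b - a) * g 0)) {a..b}"
    by (rule has_integral_linear[OF _ bounded_linear_Re, unfolded o_def])
  then show ?thesis
    by (simp add: ln_f)
qed

lemma LBINT_eq_of_has_integral:
  fixes f :: "real \<Rightarrow> real"
  assumes "continuous_on {a..b} f" "(f has_integral I) {a..b}" "a \<le> b"
  shows "(LBINT x=a..b. f x) = I"
  using assms interval_integral_eq_integral[OF _ borel_integrable_atLeastAtMost', of a b f]
  by (simp add: integral_unique)

lemma continuous_ln_norm_circle:
  assumes f: "f holomorphic_on UNIV" and nz: "\<And>w. norm w \<le> 1 \<Longrightarrow> f w \<noteq> 0"
  shows "continuous_on S (\<lambda>t. ln (norm (f (cis (- 2 * t)))))"
proof -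
  have "continuous_on S (\<lambda>t. f (cis (- 2 * t)))"
    by (rule continuous_on_compose2[OF holomorphic_on_imp_continuous_on[OF f]])
       (auto simp: cis_conv_exp intro!: continuous_intros)
  then show ?thesis
    using nz by (intro continuous_on_ln continuous_on_norm) auto
qed

section \<open>Conformal and anticonformal parts of real two-by-two matrices\<close>

text \<open>
  Identifying the plane with the complex numbers, a real matrix acts as
  \<open>z \<mapsto> a * z + b * cnj z\<close>; its conformal part is \<open>a\<close> and its anticonformal part is \<open>b\<close>.
\<close>
definition conformal_part :: "real mat \<Rightarrow> complex" where
  "conformal_part M = Complex ((M $$ (0,0) + M $$ (1,1)) / 2) ((M $$ (1,0) - M $$ (0,1)) / 2)"

definition anticonformal_part :: "real mat \<Rightarrow> complex" where
  "anticonformal_part M = Complex ((M $$ (0,0) - M $$ (1,1)) / 2) ((M $$ (1,0) + M $$ (0,1)) / 2)"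

lemma times_mat_2_entry:
  assumes "M \<in> carrier_mat 2 2" "N \<in> carrier_mat 2 2" "i < 2" "j < 2"
  shows "(M * N) $$ (i, j) = M $$ (i, 0) * N $$ (0, j) + M $$ (i, 1) * N $$ (1, j)"
  using assms by (simp add: scalar_prod_def numeral_2_eq_2)

text \<open>
  Substituting one map \<open>z \<mapsto> a * z + b * cnj z\<close> into another gives the two product rules.
\<close>
lemma conformal_part_times:
  assumes "M \<in> carrier_mat 2 2" "N \<in> carrier_mat 2 2"
  shows "conformal_part (M * N)
    = conformal_part M * conformal_part N + anticonformal_part M * cnj (anticonformal_part N)"
  unfolding conformal_part_def anticonformal_part_def
  by (simp add: times_mat_2_entry[OF assms] complex_eq_iff field_simps)

lemma anticonformal_part_times:
  assumes "M \<in> carrier_mat 2 2" "N \<in> carrier_mat 2 2"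
  shows "anticonformal_part (M * N)
    = conformal_part M * anticonformal_part N + anticonformal_part M * cnj (conformal_part N)"
  unfolding conformal_part_def anticonformal_part_def
  by (simp add: times_mat_2_entry[OF assms] complex_eq_iff field_simps)

lemma parts_rotation:
  "rotation \<theta> \<in> carrier_mat 2 2"
  "conformal_part (rotation \<theta>) = cis \<theta>" "anticonformal_part (rotation \<theta>) = 0"
  by (auto simp: conformal_part_def anticonformal_part_def rotation_def mat_of_rows_list_def
      complex_eq_iff)

lemma parts_one_mat:
  "conformal_part (1\<^sub>m 2) = 1" "anticonformal_part (1\<^sub>m 2) = 0"
  by (simp_all add: conformal_part_def anticonformal_part_def complex_eq_iff)

lemma det_mat_2:
  fixes M :: "'a :: comm_ring_1 mat"
  assumes "M \<in> carrier_mat 2 2"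
  shows "Determinant.det M = M $$ (0,0) * M $$ (1,1) - M $$ (0,1) * M $$ (1,0)"
proof -
  have minors: "mat_delete M i 0 \<in> carrier_mat 1 1" if "i < 2" for i
    using assms that by (auto simp: mat_delete_def)
  have "Determinant.det M = (\<Sum>i<2. M $$ (i,0) * cofactor M i 0)"
    using assms by (rule laplace_expansion_column) simp
  also have "\<dots> = M $$ (0,0) * M $$ (1,1) - M $$ (0,1) * M $$ (1,0)"
    using assms det_single[OF minors[of 0]] det_single[OF minors[of 1]]
    by (simp add: cofactor_def numeral_2_eq_2 mat_delete_def)
  finally show ?thesis .
qed

lemma SL2_carrier: "M \<in> SL2 \<Longrightarrow> M \<in> carrier_mat 2 2"
  by (simp add: SL2_def)

text \<open>
  The determinant of \<open>z \<mapsto> a * z + b * cnj z\<close> is the difference of the squared moduli of \<open>a\<close> and \<open>b\<close>.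
\<close>
lemma norm_conformal_part_SL2:
  assumes "M \<in> SL2"
  shows "(norm (conformal_part M))\<^sup>2 = 1 + (norm (anticonformal_part M))\<^sup>2"
proof -
  have "M $$ (0,0) * M $$ (1,1) - M $$ (0,1) * M $$ (1,0) = 1"
    using assms det_mat_2[of M] by (simp add: SL2_def)
  then show ?thesis
    unfolding cmod_power2
    by (simp add: conformal_part_def anticonformal_part_def power2_eq_square field_simps)
qed

lemma anticonformal_le_conformal:
  assumes "M \<in> SL2"
  shows "norm (anticonformal_part M) < norm (conformal_part M)" "1 \<le> norm (conformal_part M)"
  using norm_conformal_part_SL2[OF assms]
  by (auto intro: power2_less_imp_less power2_le_imp_le)

lemma rotation_SL2: "rotation \<theta> \<in> SL2"
  by (simp add: SL2_def parts_rotation det_mat_2) (simp add: rotation_def mat_of_rows_list_def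
     power2_eq_square[symmetric])

lemma SL2_times: "M \<in> SL2 \<Longrightarrow> N \<in> SL2 \<Longrightarrow> M * N \<in> SL2"
  by (auto simp: SL2_def det_mult)

lemma SL2_pow: "M \<in> SL2 \<Longrightarrow> M ^\<^sub>m k \<in> SL2"
proof (induction k)
  case 0
  then show ?case by (auto simp: SL2_def)
next
  case (Suc k)
  then show ?case by (simp add: SL2_times)
qed

lemma rotated_product_SL2:
  assumes "\<And>j. 1 \<le> j \<Longrightarrow> j \<le> k \<Longrightarrow> A j \<in> SL2"
  shows "rotated_product \<theta> A k \<in> SL2"
  using assms
proof (induction k)
  case (Suc k)
  then show ?case by (auto intro!: SL2_times rotation_SL2)
qed (simp add: SL2_def)

section \<open>The average expansion of a matrix on the projective line\<close>

text \<open>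
  Applied to \<open>z = cis p\<close> the map gives \<open>cis p * (a + b * cis (- 2 * p))\<close>, so the expansion of a line is
  the modulus of an affine function on the unit circle.
\<close>
lemma euclidean_norm_line_vec:
  assumes "M \<in> carrier_mat 2 2"
  shows "euclidean_norm (M *\<^sub>v line_vec p)
    = norm (conformal_part M + anticonformal_part M * cis (- 2 * p))"
proof -
  have dims: "dim_row M = 2" "dim_col M = 2" using assms by auto
  have "vec_index (M *\<^sub>v line_vec p) i = M $$ (i,0) * cos p + M $$ (i,1) * sin p" if "i < 2" for i
    using dims that by (simp add: line_vec_def scalar_prod_def numeral_2_eq_2)
  then have "euclidean_norm (M *\<^sub>v line_vec p)
      = norm (Complex (M $$ (0,0) * cos p + M $$ (0,1) * sin p) (M $$ (1,0) * cos p + M $$ (1,1) * sin p))"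
    using dims by (simp add: euclidean_norm_def cmod_def scalar_prod_def numeral_2_eq_2 power2_eq_square)
  also have "Complex (M $$ (0,0) * cos p + M $$ (0,1) * sin p) (M $$ (1,0) * cos p + M $$ (1,1) * sin p)
      = conformal_part M * cis p + anticonformal_part M * cis (- p)"
    by (simp add: complex_eq_iff conformal_part_def anticonformal_part_def field_simps)
  also have "\<dots> = cis p * (conformal_part M + anticonformal_part M * cis (- 2 * p))"
    by (simp add: algebra_simps cis_mult)
  finally show ?thesis by (simp add: norm_mult)
qed

text \<open>
  Since \<open>norm b < norm a\<close>, the affine function \<open>a + b * w\<close> has no zeros in the closed disc and the
  average of the logarithm of its modulus is its value at the centre.
\<close>
lemma proj_integral_ln_norm_SL2:
  assumes M: "M \<in> SL2"
  shows "proj_integral (\<lambda>p. ln (euclidean_norm (M *\<^sub>v line_vec p))) = ln (norm (conformal_part M))"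
proof -
  define f where "f = (\<lambda>w. conformal_part M + anticonformal_part M * w)"
  have f: "f holomorphic_on UNIV"
    unfolding f_def by (intro holomorphic_intros)
  have nz: "f w \<noteq> 0" if "norm w \<le> 1" for w
  proof
    assume "f w = 0"
    then have "norm (conformal_part M) = norm (anticonformal_part M) * norm w"
      unfolding f_def by (metis add_eq_0_iff norm_minus_cancel norm_mult)
    also have "\<dots> \<le> norm (anticonformal_part M)"
      using that by (simp add: mult_left_le)
    finally show False
      using anticonformal_le_conformal(1)[OF M] by simp
  qed
  have eq: "(\<lambda>p. ln (euclidean_norm (M *\<^sub>v line_vec p))) = (\<lambda>t. ln (norm (f (cis (- 2 * t)))))"
    using euclidean_norm_line_vec[OF SL2_carrier[OF M]] by (simp add: f_def)
  have "(LBINT t=-(pi/2)..pi/2. ln (norm (f (cis (- 2 * t))))) = (pi / 2 - - (pi / 2)) * ln (norm (f 0))"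
    using f nz
    by (intro LBINT_eq_of_has_integral continuous_ln_norm_circle ln_norm_circle_average)
       (auto simp: complex_eq_iff)
  then show ?thesis
    unfolding eq proj_integral_def by (simp add: f_def)
qed

section \<open>Extension of the rotated product to the unit disc\<close>

text \<open>
  These are the conformal part and the conjugate of the anticonformal part of the rotated product, both
  divided by \<open>cis \<theta> ^ k\<close>, as polynomials in \<open>w = cis (- 2 * \<theta>)\<close>. Conjugating the anticonformal part
  and removing this factor turns a trigonometric expression in \<open>\<theta>\<close> into one that makes sense, and is
  holomorphic, on the whole disc.
\<close>
fun disc_conformal disc_anticonformal :: "(nat \<Rightarrow> real mat) \<Rightarrow> nat \<Rightarrow> complex \<Rightarrow> complex" where
  "disc_conformal A 0 w = 1"
| "disc_conformal A (Suc k) w = conformal_part (A (Suc k)) * disc_conformal A k w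
     + anticonformal_part (A (Suc k)) * disc_anticonformal A k w"
| "disc_anticonformal A 0 w = 0"
| "disc_anticonformal A (Suc k) w = w * (cnj (anticonformal_part (A (Suc k))) * disc_conformal A k w
     + cnj (conformal_part (A (Suc k))) * disc_anticonformal A k w)"

lemma disc_parts_rotated_product:
  assumes "\<And>j. 1 \<le> j \<Longrightarrow> j \<le> k \<Longrightarrow> A j \<in> SL2"
  shows "conformal_part (rotated_product \<theta> A k) = cis \<theta> ^ k * disc_conformal A k (cis (- 2 * \<theta>))
    \<and> cnj (anticonformal_part (rotated_product \<theta> A k)) = cis \<theta> ^ k * disc_anticonformal A k (cis (- 2 * \<theta>))"
  using assms
proof (induction k)
  case 0
  then show ?case by (simp add: parts_one_mat)
next
  case (Suc k)
  define P where "P = rotated_product \<theta> A k"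
  have P: "P \<in> carrier_mat 2 2" and A: "A (Suc k) \<in> carrier_mat 2 2"
    unfolding P_def using Suc.prems by (auto intro!: SL2_carrier rotated_product_SL2)
  have IH: "conformal_part P = cis \<theta> ^ k * disc_conformal A k (cis (- 2 * \<theta>))"
    "cnj (anticonformal_part P) = cis \<theta> ^ k * disc_anticonformal A k (cis (- 2 * \<theta>))"
    unfolding P_def using Suc by auto
  have cis: "cnj (cis \<theta>) = cis \<theta> * cis (- 2 * \<theta>)"
    by (simp add: cis_mult cis_cnj)
  have RA: "rotation \<theta> * A (Suc k) \<in> carrier_mat 2 2"
    using parts_rotation(1) A by (rule mult_carrier_mat)
  have parts_RA: "conformal_part (rotation \<theta> * A (Suc k)) = cis \<theta> * conformal_part (A (Suc k))"
    "anticonformal_part (rotation \<theta> * A (Suc k)) = cis \<theta> * anticonformal_part (A (Suc k))"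
    by (simp_all add: conformal_part_times anticonformal_part_times A parts_rotation)
  show ?case
    unfolding rotated_product.simps P_def[symmetric] conformal_part_times[OF RA P]
      anticonformal_part_times[OF RA P] parts_RA complex_cnj_add complex_cnj_mult IH complex_cnj_cnj cis
    by (simp add: algebra_simps)
qed

text \<open>
  On the unit circle the form \<open>(norm f)\<^sup>2 - (norm g)\<^sup>2\<close> is the determinant and is preserved. Inside
  the disc, the factor \<open>w\<close> in the second component can only make the form grow. This is the
  non-vanishing that allows the mean value property to be used.
\<close>
lemma disc_indefinite_form_ge_1:
  assumes "\<And>j. 1 \<le> j \<Longrightarrow> j \<le> k \<Longrightarrow> A j \<in> SL2" and w: "norm w \<le> 1"
  shows "1 \<le> (norm (disc_conformal A k w))\<^sup>2 - (norm (disc_anticonformal A k w))\<^sup>2"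
  using assms(1)
proof (induction k)
  case (Suc k)
  define f g where "f = disc_conformal A k w" and "g = disc_anticonformal A k w"
  define a b where "a = conformal_part (A (Suc k))" and "b = anticonformal_part (A (Suc k))"
  have ab: "(norm a)\<^sup>2 - (norm b)\<^sup>2 = 1"
    using norm_conformal_part_SL2[of "A (Suc k)"] Suc.prems by (simp add: a_def b_def)
  have "1 \<le> ((norm a)\<^sup>2 - (norm b)\<^sup>2) * ((norm f)\<^sup>2 - (norm g)\<^sup>2)"
    using Suc by (simp add: ab f_def g_def)
  also have "\<dots> = (norm (a * f + b * g))\<^sup>2 - (norm (cnj b * f + cnj a * g))\<^sup>2"
    unfolding cmod_power2 by (simp add: power2_eq_square algebra_simps)
  also have "\<dots> \<le> (norm (a * f + b * g))\<^sup>2 - (norm (w * (cnj b * f + cnj a * g)))\<^sup>2"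
    using w by (simp add: norm_mult power_mult_distrib mult_left_le_one_le power_le_one)
  finally show ?case
    by (simp add: f_def g_def a_def b_def)
qed simp

lemma norm_disc_conformal_ge_1:
  assumes "\<And>j. 1 \<le> j \<Longrightarrow> j \<le> k \<Longrightarrow> A j \<in> SL2" and "norm w \<le> 1"
  shows "1 \<le> norm (disc_conformal A k w)"
proof (rule power2_le_imp_le)
  have "1 \<le> (norm (disc_conformal A k w))\<^sup>2 - (norm (disc_anticonformal A k w))\<^sup>2"
    using assms by (rule disc_indefinite_form_ge_1)
  also have "\<dots> \<le> (norm (disc_conformal A k w))\<^sup>2"
    by simp
  finally show "1\<^sup>2 \<le> (norm (disc_conformal A k w))\<^sup>2"
    by simp
qed simp

lemma disc_conformal_at_0:
  "disc_conformal A k 0 = (\<Prod>j=1..k. conformal_part (A j)) \<and> disc_anticonformal A k 0 = 0"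
  by (induction k) auto

lemma holomorphic_disc_parts:
  "disc_conformal A k holomorphic_on S \<and> disc_anticonformal A k holomorphic_on S"
proof (induction k)
  case 0
  have "disc_conformal A 0 = (\<lambda>w. 1)" "disc_anticonformal A 0 = (\<lambda>w. 0)" by auto
  then show ?case by simp
next
  case (Suc k)
  have "disc_conformal A (Suc k) = (\<lambda>w. conformal_part (A (Suc k)) * disc_conformal A k w
     + anticonformal_part (A (Suc k)) * disc_anticonformal A k w)"
   "disc_anticonformal A (Suc k) = (\<lambda>w. w * (cnj (anticonformal_part (A (Suc k))) * disc_conformal A k w
     + cnj (conformal_part (A (Suc k))) * disc_anticonformal A k w))" by auto
  then show ?case using Suc by (auto intro!: holomorphic_intros)
qed

text \<open>
  The average is the value at the centre. At \<open>w = 0\<close> the second component vanishes at every step, so the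
  first one is the product of the conformal parts; this makes the average additive in the factors.
\<close>
lemma disc_conformal_circle_average:
  assumes A: "\<And>j. 1 \<le> j \<Longrightarrow> j \<le> k \<Longrightarrow> A j \<in> SL2"
  shows "((\<lambda>\<theta>. ln (norm (disc_conformal A k (cis (- 2 * \<theta>))))) has_integral
    2 * pi * (\<Sum>j=1..k. ln (norm (conformal_part (A j))))) {0..2 * pi}"
    and "continuous_on {0..2 * pi} (\<lambda>\<theta>. ln (norm (disc_conformal A k (cis (- 2 * \<theta>)))))"
proof -
  have hol: "disc_conformal A k holomorphic_on UNIV"
    using holomorphic_disc_parts by blast
  have nz: "disc_conformal A k w \<noteq> 0" if "norm w \<le> 1" for w
    using norm_disc_conformal_ge_1[of k A w] A that by auto
  have "norm (conformal_part (A j)) > 0" if "j \<in> {1..k}" for j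
    using anticonformal_le_conformal(2)[OF A, of j] that by auto
  then have "ln (norm (disc_conformal A k 0)) = (\<Sum>j=1..k. ln (norm (conformal_part (A j))))"
    unfolding conjunct1[OF disc_conformal_at_0] prod_norm[symmetric] by (intro ln_prod) auto
  moreover have "cis (- 2 * 0) = cis (- 2 * (2 * pi))"
    using cis_multiple_2pi[of "- 2"] by (simp add: mult_ac)
  ultimately show "((\<lambda>\<theta>. ln (norm (disc_conformal A k (cis (- 2 * \<theta>))))) has_integral
    2 * pi * (\<Sum>j=1..k. ln (norm (conformal_part (A j))))) {0..2 * pi}"
    using ln_norm_circle_average[OF hol nz, of 0 "2 * pi"] by simp
  show "continuous_on {0..2 * pi} (\<lambda>\<theta>. ln (norm (disc_conformal A k (cis (- 2 * \<theta>)))))"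
    using hol nz by (rule continuous_ln_norm_circle)
qed

text \<open>
  A bound uniform in \<open>w\<close>, from which the majorant for dominated convergence comes.
\<close>
lemma norm_disc_parts_le:
  assumes A: "\<And>j. 1 \<le> j \<Longrightarrow> j \<le> k \<Longrightarrow> A j \<in> SL2" and w: "norm w \<le> 1"
  shows "norm (disc_conformal A k w) + norm (disc_anticonformal A k w)
    \<le> (\<Prod>j=1..k. 2 * norm (conformal_part (A j)))"
  using A
proof (induction k)
  case (Suc k)
  define f g where "f = disc_conformal A k w" and "g = disc_anticonformal A k w"
  define a b where "a = conformal_part (A (Suc k))" and "b = anticonformal_part (A (Suc k))"
  have ba: "norm b \<le> norm a"
    using anticonformal_le_conformal(1)[of "A (Suc k)"] Suc.prems by (simp add: a_def b_def)
  have "norm (a * f + b * g) + norm (w * (cnj b * f + cnj a * g))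
      \<le> norm (a * f + b * g) + norm (cnj b * f + cnj a * g)"
    using w by (simp add: norm_mult mult_left_le_one_le)
  also have "\<dots> \<le> (norm a * norm f + norm b * norm g) + (norm b * norm f + norm a * norm g)"
    by (intro add_mono norm_triangle_le) (simp_all add: norm_mult)
  also have "\<dots> = (norm a + norm b) * (norm f + norm g)"
    by (simp add: algebra_simps)
  also have "\<dots> \<le> (2 * norm a) * (\<Prod>j=1..k. 2 * norm (conformal_part (A j)))"
    using ba Suc by (intro mult_mono) (auto simp: f_def g_def)
  finally show ?case
    by (simp add: f_def g_def a_def b_def mult_ac)
qed simp

lemma ln_norm_disc_conformal_bounds:
  assumes A: "\<And>j. 1 \<le> j \<Longrightarrow> j \<le> k \<Longrightarrow> A j \<in> SL2" and w: "norm w \<le> 1"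
  shows "0 \<le> ln (norm (disc_conformal A k w))"
    "ln (norm (disc_conformal A k w)) \<le> (\<Sum>j=1..k. ln (2 * norm (conformal_part (A j))))"
proof -
  have ge_1: "1 \<le> norm (disc_conformal A k w)"
    using A w by (rule norm_disc_conformal_ge_1)
  then show "0 \<le> ln (norm (disc_conformal A k w))" by simp
  have pos: "2 * norm (conformal_part (A j)) > 0" if "j \<in> {1..k}" for j
    using anticonformal_le_conformal(2)[OF A, of j] that by auto
  have "norm (disc_conformal A k w) \<le> norm (disc_conformal A k w) + norm (disc_anticonformal A k w)"
    by simp
  also have "\<dots> \<le> (\<Prod>j=1..k. 2 * norm (conformal_part (A j)))"
    using A w by (rule norm_disc_parts_le)
  finally have "ln (norm (disc_conformal A k w)) \<le> ln (\<Prod>j=1..k. 2 * norm (conformal_part (A j)))"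
    using ge_1 by (intro ln_mono) auto
  also have "\<dots> = (\<Sum>j=1..k. ln (2 * norm (conformal_part (A j))))"
    using pos by (intro ln_prod) auto
  finally show "ln (norm (disc_conformal A k w)) \<le> (\<Sum>j=1..k. ln (2 * norm (conformal_part (A j))))" .
qed

section \<open>The spectral radius as a growth rate\<close>

text \<open>
  In \<open>SL2\<close> the conformal part dominates the anticonformal part, hence the modulus of the conformal part
  is comparable to the largest entry. It can therefore replace the norm in Gelfand's formula.
\<close>
lemma abs_entry_le_conformal_part:
  assumes M: "M \<in> SL2" and ij: "i < 2" "j < 2"
  shows "\<bar>M $$ (i, j)\<bar> \<le> 2 * norm (conformal_part M)"
proof -
  let ?a = "conformal_part M" and ?b = "anticonformal_part M"
  have "M $$ (i, j) \<in> {Re ?a + Re ?b, Re ?a - Re ?b, Im ?a + Im ?b, Im ?b - Im ?a}"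
    using ij by (auto simp: less_2_cases_iff conformal_part_def anticonformal_part_def field_simps)
  moreover have "norm ?b < norm ?a"
    using M by (rule anticonformal_le_conformal)
  ultimately show ?thesis
    using abs_Re_le_cmod[of ?a] abs_Im_le_cmod[of ?a] abs_Re_le_cmod[of ?b] abs_Im_le_cmod[of ?b]
    by auto
qed

lemma norm_conformal_part_le:
  assumes "\<And>i j. i < 2 \<Longrightarrow> j < 2 \<Longrightarrow> \<bar>M $$ (i, j)\<bar> \<le> c"
  shows "norm (conformal_part M) \<le> 2 * c"
proof -
  have "\<bar>Re (conformal_part M)\<bar> \<le> c" "\<bar>Im (conformal_part M)\<bar> \<le> c"
    using assms[of 0 0] assms[of 1 1] assms[of 1 0] assms[of 0 1]
    by (auto simp: conformal_part_def)
  then show ?thesis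
    using cmod_le[of "conformal_part M"] by linarith
qed

lemma spectral_radius_SL2_pos:
  assumes "M \<in> SL2"
  shows "0 < spectral_radius (map_mat complex_of_real M)"
proof -
  let ?C = "map_mat complex_of_real M"
  have C: "?C \<in> carrier_mat 2 2"
    using assms SL2_carrier by simp
  obtain ev where ev: "eigenvalue ?C ev" "norm ev = spectral_radius ?C"
    using spectral_radius_mem_max(1)[OF C] by (auto simp: spectrum_def)
  have "Determinant.det ?C = 1"
    using assms of_real_hom.hom_det[of M] by (simp add: SL2_def)
  moreover have "0 \<cdot>\<^sub>v v = 0\<^sub>v 2" if "v \<in> carrier_vec 2" for v :: "complex Matrix.vec"
    using that by (intro eq_vecI) auto
  ultimately have "ev \<noteq> 0"
    using ev(1) C det_0_iff_vec_prod_zero_field[OF C]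
    by (auto simp: eigenvalue_def eigenvector_def)
  then show ?thesis
    using ev(2) by (metis zero_less_norm_iff)
qed

text \<open>
  An eigenvector for an eigenvalue of maximal modulus is expanded by exactly this modulus at every step,
  which forces the entries of the powers to be large.
\<close>
lemma spectral_radius_power_le:
  assumes M: "M \<in> SL2"
  shows "spectral_radius (map_mat complex_of_real M) ^ k \<le> 4 * norm (conformal_part (M ^\<^sub>m k))"
proof -
  let ?C = "map_mat complex_of_real M" and ?a = "norm (conformal_part (M ^\<^sub>m k))"
  have M': "M \<in> carrier_mat 2 2" and C: "?C \<in> carrier_mat 2 2"
    using assms SL2_carrier by auto
  obtain ev where ev: "eigenvalue ?C ev" "norm ev = spectral_radius ?C"
    using spectral_radius_mem_max(1)[OF C] by (auto simp: spectrum_def)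
  obtain v where v: "eigenvector ?C v ev"
    using ev(1) by (auto simp: eigenvalue_def)
  have v': "dim_vec v = 2" "v \<noteq> 0\<^sub>v 2"
    using v C by (auto simp: eigenvector_def)
  \<comment> \<open>The coordinate of largest modulus is compared before and after applying the power.\<close>
  obtain i where i: "i < 2" "\<And>j. j < 2 \<Longrightarrow> norm (vec_index v j) \<le> norm (vec_index v i)"
  proof (cases "norm (vec_index v 0) \<le> norm (vec_index v 1)")
    case True
    then show ?thesis by (intro that[of 1]) (auto simp: less_2_cases_iff)
  next
    case False
    then show ?thesis by (intro that[of 0]) (auto simp: less_2_cases_iff)
  qed
  have vi: "vec_index v i \<noteq> 0"
  proof
    assume "vec_index v i = 0"
    then have "v = 0\<^sub>v 2"
      using i v'(1) by (intro eq_vecI) auto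
    with v'(2) show False ..
  qed
  have pow: "?C ^\<^sub>m k = map_mat complex_of_real (M ^\<^sub>m k)"
    using M' by (rule of_real_hom.mat_hom_pow[symmetric])
  have "(?C ^\<^sub>m k) *\<^sub>v v = ev ^ k \<cdot>\<^sub>v v"
    using eigenvector_pow[OF C v] .
  then have "ev ^ k * vec_index v i = vec_index (?C ^\<^sub>m k *\<^sub>v v) i"
    using i v' by simp
  also have "\<dots> = of_real ((M ^\<^sub>m k) $$ (i, 0)) * vec_index v 0 + of_real ((M ^\<^sub>m k) $$ (i, 1)) * vec_index v 1"
    unfolding pow using i v' M' pow_carrier_mat[OF M', of k]
    by (simp add: scalar_prod_def numeral_2_eq_2)
  finally have "norm (ev ^ k * vec_index v i) \<le>
      \<bar>(M ^\<^sub>m k) $$ (i, 0)\<bar> * norm (vec_index v 0) + \<bar>(M ^\<^sub>m k) $$ (i, 1)\<bar> * norm (vec_index v 1)"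
    by (metis norm_mult norm_of_real norm_triangle_ineq)
  also have "\<dots> \<le> 2 * ?a * norm (vec_index v i) + 2 * ?a * norm (vec_index v i)"
    using i SL2_pow[OF M, of k] by (intro add_mono mult_mono abs_entry_le_conformal_part) auto
  finally have "norm ev ^ k * norm (vec_index v i) \<le> 4 * ?a * norm (vec_index v i)"
    by (simp add: norm_mult norm_power mult_ac)
  then show ?thesis
    using vi ev(2) by simp
qed

text \<open>
  The powers of a complex matrix of spectral radius at most one grow at most polynomially, by the Jordan
  normal form; this is applied to the matrix divided by its spectral radius.
\<close>
lemma conformal_part_power_le:
  assumes M: "M \<in> SL2"
  obtains c where "0 < c" "\<And>k. norm (conformal_part (M ^\<^sub>m k))
    \<le> c * (1 + real k) * spectral_radius (map_mat complex_of_real M) ^ k"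
proof -
  let ?C = "map_mat complex_of_real M"
  define r where "r = spectral_radius ?C"
  have r: "0 < r"
    unfolding r_def using M by (rule spectral_radius_SL2_pos)
  have M': "M \<in> carrier_mat 2 2" and C: "?C \<in> carrier_mat 2 2"
    using assms SL2_carrier by auto
  define B where "B = complex_of_real (1 / r) \<cdot>\<^sub>m ?C"
  have B: "B \<in> carrier_mat 2 2"
    using C by (simp add: B_def)
  have C_B: "?C = complex_of_real r \<cdot>\<^sub>m B"
    using r by (auto simp: B_def)
  have "norm ev \<le> 1" if ev: "eigenvalue B ev" for ev
  proof -
    obtain v where v: "v \<in> carrier_vec 2" "v \<noteq> 0\<^sub>v 2" "B *\<^sub>v v = ev \<cdot>\<^sub>v v"
      using ev B by (auto simp: eigenvalue_def eigenvector_def)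
    have "?C *\<^sub>v v = (of_real r * ev) \<cdot>\<^sub>v v"
    proof -
      have "?C *\<^sub>v v = of_real r \<cdot>\<^sub>v (B *\<^sub>v v)"
        unfolding C_B using v(1) B
        by (intro eq_vecI) (auto simp: scalar_prod_def sum_distrib_left mult.assoc)
      then show ?thesis
        by (simp add: v smult_smult_assoc)
    qed
    then have "eigenvalue ?C (r * ev)"
      using v C by (auto simp: eigenvalue_def eigenvector_def)
    then have "norm (r * ev) \<le> r"
      unfolding r_def by (intro spectral_radius_mem_max(2)[OF C]) (auto simp: spectrum_def)
    then show ?thesis
      using r by (simp add: norm_mult)
  qed
  then have "spectral_radius B \<le> 1"
    using spectral_radius_mem_max(1)[OF B] by (auto simp: spectrum_def)
  then obtain c1 c2 where c: "\<And>k. norm_bound (B ^\<^sub>m k) (c1 + c2 * real k ^ 1)"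
    using spectral_radius_jnf_norm_bound_le_1_upper_triangular[OF B] by auto
  have pow: "map_mat complex_of_real (M ^\<^sub>m k) = complex_of_real r ^ k \<cdot>\<^sub>m (B ^\<^sub>m k)" for k
  proof (induction k)
    case 0
    then show ?case using M' B by auto
  next
    case (Suc k)
    have Bk: "B ^\<^sub>m k \<in> carrier_mat 2 2" using B by (rule pow_carrier_mat)
    have "map_mat complex_of_real (M ^\<^sub>m Suc k) = map_mat complex_of_real (M ^\<^sub>m k) * ?C"
      using of_real_hom.mat_hom_mult[OF pow_carrier_mat[OF M'] M'] by simp
    also have "\<dots> = complex_of_real r \<cdot>\<^sub>m (complex_of_real r ^ k \<cdot>\<^sub>m (B ^\<^sub>m k * B))"
      unfolding Suc C_B
        mult_smult_assoc_mat[OF Bk smult_carrier_mat[OF B]] mult_smult_distrib[OF Bk B]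
      by (intro eq_matI) auto
    also have "\<dots> = complex_of_real r ^ Suc k \<cdot>\<^sub>m (B ^\<^sub>m Suc k)"
      by (intro eq_matI) auto
    finally show ?case .
  qed
  have entry: "\<bar>(M ^\<^sub>m k) $$ (i, j)\<bar> \<le> (1 + \<bar>c1\<bar> + \<bar>c2\<bar>) * (1 + real k) * r ^ k" if "i < 2" "j < 2" for i j k
  proof -
    have dims: "dim_row (B ^\<^sub>m k) = 2" "dim_col (B ^\<^sub>m k) = 2" "dim_row (M ^\<^sub>m k) = 2" "dim_col (M ^\<^sub>m k) = 2"
      using pow_carrier_mat[OF B, of k] pow_carrier_mat[OF M', of k] by auto
    have "complex_of_real ((M ^\<^sub>m k) $$ (i, j)) = of_real r ^ k * (B ^\<^sub>m k) $$ (i, j)"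
      using arg_cong[OF pow[of k], of "\<lambda>X. X $$ (i, j)"] dims that by simp
    then have "\<bar>(M ^\<^sub>m k) $$ (i, j)\<bar> = r ^ k * norm ((B ^\<^sub>m k) $$ (i, j))"
      using r by (metis abs_of_pos norm_mult norm_of_real norm_power)
    also have "norm ((B ^\<^sub>m k) $$ (i, j)) \<le> c1 + c2 * real k"
      using c[of k] that dims by (simp add: norm_bound_def)
    also have "c1 + c2 * real k \<le> \<bar>c1\<bar> + \<bar>c2\<bar> * real k"
      by (intro add_mono mult_right_mono) auto
    also have "\<dots> \<le> (1 + \<bar>c1\<bar> + \<bar>c2\<bar>) * (1 + real k)"
      by (simp add: algebra_simps)
    finally show ?thesis
      using r by (simp add: mult_ac)
  qed
  show thesis
  proof (rule that)
    show "0 < 2 * (1 + \<bar>c1\<bar> + \<bar>c2\<bar>)" by simp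
    show "norm (conformal_part (M ^\<^sub>m k)) \<le> 2 * (1 + \<bar>c1\<bar> + \<bar>c2\<bar>) * (1 + real k) * spectral_radius ?C ^ k" for k
      using norm_conformal_part_le[OF entry, of k] unfolding r_def[symmetric] by (simp only: mult.assoc)
  qed
qed

text \<open>
  Gelfand's formula, with the modulus of the conformal part in the role of the norm.
\<close>
lemma ln_conformal_part_power_tendsto:
  assumes M: "M \<in> SL2"
  shows "(\<lambda>k. ln (norm (conformal_part (M ^\<^sub>m k))) / real k) \<longlonglongrightarrow> log_spectral_radius M"
proof -
  define r where "r = spectral_radius (map_mat complex_of_real M)"
  have r: "0 < r"
    unfolding r_def using M by (rule spectral_radius_SL2_pos)
  obtain c where c: "0 < c" "\<And>k. norm (conformal_part (M ^\<^sub>m k)) \<le> c * (1 + real k) * r ^ k"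
    using conformal_part_power_le[OF M] unfolding r_def by blast
  have ge_1: "1 \<le> norm (conformal_part (M ^\<^sub>m k))" for k
    using M by (intro anticonformal_le_conformal SL2_pow)
  have lower: "(ln r * real k - ln 4) / real k \<le> ln (norm (conformal_part (M ^\<^sub>m k))) / real k" for k
  proof (rule divide_right_mono)
    have "ln (r ^ k) \<le> ln (4 * norm (conformal_part (M ^\<^sub>m k)))"
      using spectral_radius_power_le[OF M, of k] r ge_1[of k] by (intro ln_mono) (auto simp: r_def)
    then show "ln r * real k - ln 4 \<le> ln (norm (conformal_part (M ^\<^sub>m k)))"
      using r ge_1[of k] by (auto simp: ln_mult ln_realpow mult.commute split: if_splits)
  qed simp
  have upper: "ln (norm (conformal_part (M ^\<^sub>m k))) / real k \<le> (ln r * real k + ln c + ln (1 + real k)) / real k" for k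
  proof (rule divide_right_mono)
    have "ln (norm (conformal_part (M ^\<^sub>m k))) \<le> ln (c * (1 + real k) * r ^ k)"
      using c(2)[of k] ge_1[of k] by (intro ln_mono) auto
    then show "ln (norm (conformal_part (M ^\<^sub>m k))) \<le> ln r * real k + ln c + ln (1 + real k)"
      using r c(1) by (simp add: ln_mult ln_realpow mult.commute)
  qed simp
  have "(\<lambda>k. (ln r * real k - ln 4) / real k) \<longlonglongrightarrow> ln r"
    by real_asymp
  moreover have "(\<lambda>k. (ln r * real k + ln c + ln (1 + real k)) / real k) \<longlonglongrightarrow> ln r"
    by real_asymp
  ultimately show ?thesis
    unfolding log_spectral_radius_def r_def[symmetric]
    by (rule tendsto_sandwich[rotated 2]) (auto simp: lower upper)
qed

section \<open>Powers of rotated products\<close>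

text \<open>
  The sequence is indexed from 1, as the factors of the rotated product are.
\<close>
definition repeat_periodically :: "nat \<Rightarrow> (nat \<Rightarrow> 'a) \<Rightarrow> nat \<Rightarrow> 'a" where
  "repeat_periodically n A j = A (Suc ((j - 1) mod n))"

lemma repeat_periodically_simps:
  "1 \<le> j \<Longrightarrow> j \<le> n \<Longrightarrow> repeat_periodically n A j = A j"
  "1 \<le> j \<Longrightarrow> repeat_periodically n A (j + n) = repeat_periodically n A j"
proof -
  assume "1 \<le> j"
  then have "j + n - 1 = (j - 1) + n" by simp
  then show "repeat_periodically n A (j + n) = repeat_periodically n A j"
    by (simp only: repeat_periodically_def mod_add_self2)
qed (simp add: repeat_periodically_def)

lemma repeat_periodically_in:
  assumes "1 \<le> n" "\<And>j. j \<in> {1..n} \<Longrightarrow> A j \<in> S"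
  shows "repeat_periodically n A j \<in> S"
  unfolding repeat_periodically_def using assms(1) by (intro assms(2)) (simp add: Suc_leI)

lemma sum_repeat_periodically:
  fixes h :: "'a \<Rightarrow> real"
  shows "(\<Sum>j=1..k * n. h (repeat_periodically n A j)) = real k * (\<Sum>j=1..n. h (A j))"
proof (induction k)
  case (Suc k)
  have "(\<Sum>j=1..Suc k * n. h (repeat_periodically n A j)) = (\<Sum>j=1..n + k * n. h (repeat_periodically n A j))"
    by simp
  also have "\<dots> = (\<Sum>j=1..n. h (repeat_periodically n A j)) + (\<Sum>j=n+1..n + k * n. h (repeat_periodically n A j))"
    by (rule sum.ub_add_nat) simp
  also have "(\<Sum>j=n+1..n + k * n. h (repeat_periodically n A j)) = (\<Sum>j=1..k * n. h (repeat_periodically n A (j + n)))"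
    using sum.shift_bounds_cl_nat_ivl[of "\<lambda>j. h (repeat_periodically n A j)" 1 n "k * n"] by (simp add: add.commute)
  finally show ?case
    using Suc by (simp add: repeat_periodically_simps algebra_simps)
qed simp

lemma rotated_product_cong:
  assumes "\<And>j. 1 \<le> j \<Longrightarrow> j \<le> k \<Longrightarrow> A j = B j"
  shows "rotated_product \<theta> A k = rotated_product \<theta> B k"
  using assms by (induction k) auto

lemma rotated_product_add:
  assumes "\<And>j. A j \<in> SL2"
  shows "rotated_product \<theta> A (m + k) = rotated_product \<theta> (\<lambda>j. A (j + m)) k * rotated_product \<theta> A m"
proof (induction k)
  case 0
  show ?case
    using SL2_carrier[OF rotated_product_SL2[of m A \<theta>]] assms by simp
next
  case (Suc k)
  have "rotation \<theta> * A (Suc (k + m)) \<in> carrier_mat 2 2"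
    "rotated_product \<theta> (\<lambda>j. A (j + m)) k \<in> carrier_mat 2 2" "rotated_product \<theta> A m \<in> carrier_mat 2 2"
    using assms by (auto intro!: SL2_carrier SL2_times rotation_SL2 rotated_product_SL2)
  then show ?case
    using Suc by (simp add: assoc_mult_mat[of _ 2 2 _ 2 _ 2] add.commute)
qed

text \<open>
  Powers of a rotated product are again rotated products, to which the average formula applies.
\<close>
lemma rotated_product_repeat_periodically:
  assumes n: "1 \<le> n" and A: "\<And>j. j \<in> {1..n} \<Longrightarrow> A j \<in> SL2"
  shows "rotated_product \<theta> (repeat_periodically n A) (k * n) = rotated_product \<theta> A n ^\<^sub>m k"
proof (induction k)
  case 0
  have "rotated_product \<theta> A n \<in> carrier_mat 2 2"
    using A by (intro SL2_carrier rotated_product_SL2) auto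
  then show ?case by simp
next
  case (Suc k)
  let ?A = "repeat_periodically n A"
  have "rotated_product \<theta> ?A (Suc k * n) = rotated_product \<theta> (\<lambda>j. ?A (j + n)) (k * n) * rotated_product \<theta> ?A n"
    using rotated_product_add[of ?A \<theta> n "k * n"] repeat_periodically_in[of n A SL2] n A by simp
  also have "rotated_product \<theta> (\<lambda>j. ?A (j + n)) (k * n) = rotated_product \<theta> ?A (k * n)"
    by (intro rotated_product_cong repeat_periodically_simps)
  also have "rotated_product \<theta> ?A n = rotated_product \<theta> A n"
    by (intro rotated_product_cong repeat_periodically_simps)
  finally show ?case
    using Suc by simp
qed

section \<open>The average of the logarithm of the spectral radius\<close>

theorem theorem3:
  fixes n :: nat and A :: "nat \<Rightarrow> real mat"
  assumes "n \<ge> 1"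
    and "\<And>j. j \<in> {1..n} \<Longrightarrow> A j \<in> SL2"
  shows "(1 / (2 * pi)) * (LBINT \<theta>=0..2*pi. log_spectral_radius (rotated_product \<theta> A n))
    = (\<Sum>j=1..n. proj_integral (\<lambda>p. ln (euclidean_norm (A j *\<^sub>v line_vec p))))"
proof -
  let ?P = "\<lambda>\<theta>. rotated_product \<theta> A n"
  define B where "B = repeat_periodically n A"
  have B: "B j \<in> SL2" for j
    unfolding B_def using assms by (rule repeat_periodically_in)
  have sum_B: "(\<Sum>j=1..k * n. h (B j)) = real k * (\<Sum>j=1..n. h (A j))" for k and h :: "real mat \<Rightarrow> real"
    unfolding B_def by (rule sum_repeat_periodically)
  define L where "L = (\<Sum>j=1..n. ln (norm (conformal_part (A j))))"
  define bound where "bound = (\<Sum>j=1..n. ln (2 * norm (conformal_part (A j))))"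
  \<comment> \<open>The exponent is \<open>Suc k\<close>, so that the average is \<open>2 * pi * L\<close> for every index.\<close>
  define s where "s = (\<lambda>k \<theta>. ln (norm (disc_conformal B (Suc k * n) (cis (- 2 * \<theta>)))) / real (Suc k))"
  have s_eq: "s k \<theta> = ln (norm (conformal_part (?P \<theta> ^\<^sub>m Suc k))) / real (Suc k)" for k \<theta>
  proof -
    have "conformal_part (?P \<theta> ^\<^sub>m Suc k) = cis \<theta> ^ (Suc k * n) * disc_conformal B (Suc k * n) (cis (- 2 * \<theta>))"
      using disc_parts_rotated_product[where k = "Suc k * n" and A = B and \<theta> = \<theta>] B
        rotated_product_repeat_periodically[OF assms, where k = "Suc k" and \<theta> = \<theta>]
      by (simp only: B_def)
    then show ?thesis
      by (simp add: s_def norm_mult norm_power del: mult_Suc)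
  qed
  have pointwise: "(\<lambda>k. s k \<theta>) \<longlonglongrightarrow> log_spectral_radius (?P \<theta>)" for \<theta>
    unfolding s_eq using assms(2)
    by (intro LIMSEQ_Suc[OF ln_conformal_part_power_tendsto] rotated_product_SL2) auto
  have s_bound: "norm (s k \<theta>) \<le> bound" for k \<theta>
  proof -
    have "ln (norm (disc_conformal B (Suc k * n) (cis (- 2 * \<theta>)))) \<le> real (Suc k) * bound"
      unfolding bound_def sum_B[where h = "\<lambda>M. ln (2 * norm (conformal_part M))", symmetric]
      using B by (intro ln_norm_disc_conformal_bounds) auto
    moreover have "0 \<le> ln (norm (disc_conformal B (Suc k * n) (cis (- 2 * \<theta>))))"
      using B by (intro ln_norm_disc_conformal_bounds) auto
    ultimately show ?thesis
      by (simp add: s_def divide_le_eq mult.commute del: mult_Suc of_nat_Suc)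
  qed
  have s_cont: "continuous_on {0..2 * pi} (s k)" for k
    unfolding s_def using B
    by (intro continuous_on_divide disc_conformal_circle_average continuous_on_const) auto
  have s_avg: "(s k has_integral 2 * pi * L) {0..2 * pi}" for k
  proof -
    have "(s k has_integral 2 * pi * (real (Suc k) * L) / real (Suc k)) {0..2 * pi}"
      unfolding s_def L_def sum_B[where h = "\<lambda>M. ln (norm (conformal_part M))", symmetric]
      using B by (intro has_integral_divide disc_conformal_circle_average) auto
    then show ?thesis by (simp del: of_nat_Suc add: mult.assoc)
  qed
  have s_int: "set_integrable lborel {0..2 * pi} (s k)" for k
    using s_cont by (rule borel_integrable_atLeastAtMost')
  have "(LBINT \<theta>:{0..2 * pi}. s k \<theta>) = 2 * pi * L" for k
    using set_borel_integral_eq_integral(2)[OF s_int] s_avg by (simp add: integral_unique)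
  moreover have "(\<lambda>k. LBINT \<theta>:{0..2 * pi}. s k \<theta>)
      \<longlonglongrightarrow> (LBINT \<theta>:{0..2 * pi}. log_spectral_radius (?P \<theta>))"
    unfolding set_lebesgue_integral_def
  proof (rule integral_dominated_convergence[where w = "\<lambda>\<theta>. indicator {0..2 * pi} \<theta> *\<^sub>R bound"])
    show meas: "(\<lambda>\<theta>. indicator {0..2 * pi} \<theta> *\<^sub>R s k \<theta>) \<in> borel_measurable lborel" for k
      using s_int unfolding set_integrable_def by (rule borel_measurable_integrable)
    have lim: "(\<lambda>k. indicator {0..2 * pi} \<theta> *\<^sub>R s k \<theta>)
        \<longlonglongrightarrow> indicator {0..2 * pi} \<theta> *\<^sub>R log_spectral_radius (?P \<theta>)" for \<theta> :: real
      by (intro tendsto_scaleR tendsto_const pointwise)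
    show "(\<lambda>\<theta>. indicator {0..2 * pi} \<theta> *\<^sub>R log_spectral_radius (?P \<theta>)) \<in> borel_measurable lborel"
      by (rule borel_measurable_LIMSEQ_real[OF lim meas])
    show "integrable lborel (\<lambda>\<theta>. indicator {0..2 * pi} \<theta> *\<^sub>R bound)"
      using borel_integrable_atLeastAtMost'[of 0 "2 * pi" "\<lambda>_. bound"] by (simp add: set_integrable_def)
    show "AE \<theta> in lborel. (\<lambda>k. indicator {0..2 * pi} \<theta> *\<^sub>R s k \<theta>)
        \<longlonglongrightarrow> indicator {0..2 * pi} \<theta> *\<^sub>R log_spectral_radius (?P \<theta>)"
      using lim by simp
    show "AE \<theta> in lborel. norm (indicator {0..2 * pi} \<theta> *\<^sub>R s k \<theta>) \<le> indicator {0..2 * pi} \<theta> *\<^sub>R bound" for k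
      using s_bound[of k] by (auto simp: indicator_def)
  qed
  ultimately have "(LBINT \<theta>:{0..2 * pi}. log_spectral_radius (?P \<theta>)) = 2 * pi * L"
    by (simp add: LIMSEQ_const_iff)
  then have "(LBINT \<theta>=0..2*pi. log_spectral_radius (?P \<theta>)) = 2 * pi * L"
    using interval_integral_Icc[of 0 "2 * pi" "\<lambda>\<theta>. log_spectral_radius (?P \<theta>)"]
    by (simp add: zero_ereal_def)
  then show ?thesis
    using assms(2) by (simp add: L_def proj_integral_ln_norm_SL2)
qed

end
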